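(* For $n\geq1$, $$\sum_{e\in\mathbf{I}_n(\geq,\geq,>)}u^{n+1-\mathrm{cri}(e)}=\sum_{\pi\in\mathfrak{S}_n(2\underline{41}3,3\underline{14}2)}u^{\mathrm{lma}(\pi)+\mathrm{rma}(\pi)}.$$
   Context: $\mathbf{I}_n=\{(e_1,\ldots,e_n): 0\leq e_i<i\}$. $\mathbf{I}_n(\geq,\geq,>)$ is the set of $e\in\mathbf{I}_n$ with no $i<j<k$ such that $e_i\geq e_j\geq e_k$ and $e_i>e_k$. For $e\in\mathbf{I}_n(\geq,\geq,>)$, $\mathrm{cri}(e)$ is the minimal integer $c\geq0$ such that $(e_1,\ldots,e_n,c)\in\mathbf{I}_{n+1}(\geq,\geq,>)$. $\mathfrak{S}_n(2\underline{41}3,3\underline{14}2)$ is the set of Baxter permutations: permutations $\pi$ of $\{1,\ldots,n\}$ with no indices $i<j<k$ (with $j+1<k$) such that $\pi_{j+1}<\pi_i<\pi_k<\pi_j$ or $\pi_j<\pi_k<\pi_i<\pi_{j+1}$. $\mathrm{lma}(\pi)$ is the number of left-to-right maxima (positions $i$ with $\pi_i>\pi_j$ for all $j<i$) and $\mathrm{rma}(\pi)$ the number of right-to-left maxima (positions $i$ with $\pi_i>\pi_j$ for all $j>i$). *)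

theory Defs
  imports "HOL-Combinatorics.Multiset_Permutations"
begin

text \<open>
  Inversion sequences and permutations (in one-line notation) are lists. List positions start
  at 0, so the entry \<open>e\<^sub>i\<close> is \<open>e ! (i - 1)\<close>; in particular the bound \<open>0 \<le> e\<^sub>i < i\<close>
  becomes \<open>e ! i < Suc i\<close>.
\<close>

definition inversion_seqs :: "nat \<Rightarrow> nat list set" where
  "inversion_seqs n = {e. length e = n \<and> (\<forall>i<n. e ! i < Suc i)}"

definition inversion_seqs_avoiding :: "nat \<Rightarrow> nat list set" where
  "inversion_seqs_avoiding n =
     {e \<in> inversion_seqs n.
        \<not> (\<exists>i j k. i < j \<and> j < k \<and> k < n \<and>
             e ! i \<ge> e ! j \<and> e ! j \<ge> e ! k \<and> e ! i > e ! k)}"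

definition cri :: "nat list \<Rightarrow> nat" where
  "cri e = (LEAST c. e @ [c] \<in> inversion_seqs_avoiding (Suc (length e)))"

definition baxter_perms :: "nat \<Rightarrow> nat list set" where
  "baxter_perms n =
     {\<pi> \<in> permutations_of_set {1..n}.
        \<not> (\<exists>i j k. i < j \<and> j + 1 < k \<and> k < n \<and>
             (\<pi> ! (j + 1) < \<pi> ! i \<and> \<pi> ! i < \<pi> ! k \<and> \<pi> ! k < \<pi> ! j \<or>
              \<pi> ! j < \<pi> ! k \<and> \<pi> ! k < \<pi> ! i \<and> \<pi> ! i < \<pi> ! (j + 1)))}"

definition lma :: "nat list \<Rightarrow> nat" where
  "lma \<pi> = card {i. i < length \<pi> \<and> (\<forall>j<i. \<pi> ! i > \<pi> ! j)}"

definition rma :: "nat list \<Rightarrow> nat" where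
  "rma \<pi> = card {i. i < length \<pi> \<and> (\<forall>j. i < j \<and> j < length \<pi> \<longrightarrow> \<pi> ! i > \<pi> ! j)}"

end

theory Submission
  imports Defs Complex_Main "HOL-Computational_Algebra.Polynomial"
begin

text \<open>
  Both families grow by a two-parameter succession rule. Deleting the largest letter of a Baxter
  permutation with \<open>p\<close> left-to-right and \<open>q\<close> right-to-left maxima gives the rule
  \<open>(p, q) \<rightarrow> (1, q + 1), \<dots>, (p, q + 1), (p + 1, 1), \<dots>, (p + 1, q)\<close>. Deleting the last entry of an inversion
  sequence with \<open>r = n - cri e\<close> and \<open>k = n - max e\<close> gives
  \<open>(r, k) \<rightarrow> (k + 1, k + 1), (k + 1, k + 1), \<dots>, (r, k + 1), (r + 1, 1), \<dots>, (r + 1, k)\<close>.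
  With this choice of parameters the generating functions \<open>G\<^sub>n(x, y)\<close> and \<open>F\<^sub>n(x, y)\<close>
  satisfy functional equations with the same kernel. Eliminating the boundary term \<open>F\<^sub>n(1, x y)\<close>,
  which is symmetric in \<open>x\<close> and \<open>y\<close>, expresses \<open>G\<^sub>n\<close> through \<open>F\<^sub>n\<close>: with \<open>a = x - 1\<close> and \<open>b = y - 1\<close>,
  \<open>2 (a + b) x y G\<^sub>n(x, y) = (a - b) (a (b - 1) F\<^bsub>n+1\<^esub>(x, y) - b (a - 1) F\<^bsub>n+1\<^esub>(y, x))
    + 2 x y (a x F\<^sub>n(x, 1) + b y F\<^sub>n(y, 1))\<close>.
  This follows by induction on \<open>n\<close> (setting \<open>x = 1\<close> or \<open>y = 1\<close> in it gives the boundary terms of the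
  next step), and on the diagonal it reads \<open>G\<^sub>n(x, x) = x F\<^sub>n(x, 1)\<close>.
\<close>

section \<open>Insertion of the maximum into Baxter permutations\<close>

lemma lma_Nil [simp]: "lma [] = 0" by (simp add: lma_def)

lemma rma_Nil [simp]: "rma [] = 0" by (simp add: rma_def)

lemma lma_snoc: "lma (xs @ [x]) = lma xs + (if \<forall>y\<in>set xs. y < x then 1 else 0)"
proof -
  let ?A = "{i. i < length xs \<and> (\<forall>j<i. xs ! j < xs ! i)}"
  have "{i. i < length (xs @ [x]) \<and> (\<forall>j<i. (xs @ [x]) ! j < (xs @ [x]) ! i)}
      = ?A \<union> (if \<forall>y\<in>set xs. y < x then {length xs} else {})"
    by (auto simp: nth_append all_set_conv_all_nth less_Suc_eq)
  moreover have "length xs \<notin> ?A" "finite ?A" by auto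
  ultimately show ?thesis by (auto simp: lma_def)
qed

lemma rma_Cons: "rma (x # xs) = rma xs + (if \<forall>y\<in>set xs. y < x then 1 else 0)"
proof -
  let ?A = "{i. i < length xs \<and> (\<forall>j. i < j \<and> j < length xs \<longrightarrow> xs ! j < xs ! i)}"
  have "{i. i < length (x # xs) \<and> (\<forall>j. i < j \<and> j < length (x # xs) \<longrightarrow> (x # xs) ! j < (x # xs) ! i)}
      = Suc ` ?A \<union> (if \<forall>y\<in>set xs. y < x then {0} else {})" (is "?L = ?R")
  proof (rule set_eqI)
    fix i show "i \<in> ?L \<longleftrightarrow> i \<in> ?R"
      by (cases i) (auto simp: all_set_conv_all_nth image_iff nth_Cons split: nat.splits)
  qed
  moreover have "0 \<notin> Suc ` ?A" "finite ?A" by auto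
  ultimately show ?thesis by (auto simp: rma_def card_image)
qed

lemma lma_insert_max:
  assumes "\<forall>a\<in>set as. a < N" "\<forall>b\<in>set bs. b < N"
  shows "lma (as @ N # bs) = Suc (lma as)"
  using assms(2)
proof (induction bs rule: rev_induct)
  case Nil
  then show ?case using assms(1) by (simp add: lma_snoc)
next
  case (snoc b bs)
  then show ?case using lma_snoc[of "as @ N # bs" b] by auto
qed

lemma rma_insert_max:
  assumes "\<forall>a\<in>set as. a < N" "\<forall>b\<in>set bs. b < N"
  shows "rma (as @ N # bs) = Suc (rma bs)"
  using assms by (induction as) (auto simp: rma_Cons)

lemma rma_append_left_max:
  assumes "\<forall>a\<in>set as. a < h"
  shows "rma (as @ h # bs) = rma (h # bs)"
  using assms by (induction as) (auto simp: rma_Cons)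

lemma lma_append_right_max:
  assumes "\<forall>b\<in>set bs. b < l"
  shows "lma (as @ l # bs) = lma (as @ [l])"
  using assms
proof (induction bs rule: rev_induct)
  case (snoc b bs)
  then show ?case using lma_snoc[of "as @ l # bs" b] by auto
qed simp

definition lr_max_positions :: "nat list \<Rightarrow> nat set" where
  "lr_max_positions xs = {i. i < length xs \<and> (\<forall>y\<in>set (take i xs). y < xs ! i)}"

definition rl_max_positions :: "nat list \<Rightarrow> nat set" where
  "rl_max_positions xs = {i. i < length xs \<and> (\<forall>y\<in>set (drop (Suc i) xs). y < xs ! i)}"

lemma finite_max_positions [simp]:
  "finite (lr_max_positions xs)" "finite (rl_max_positions xs)"
  by (simp_all add: lr_max_positions_def rl_max_positions_def)

text \<open>The k-th left-to-right maximum is preceded by exactly k - 1 others, so the argument of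
  \<open>f\<close> runs through 1, ..., \<open>lma xs\<close>. This turns a sum over insertion sites
  into a geometric sum.\<close>

lemma sum_lr_max_positions:
  "(\<Sum>i\<in>lr_max_positions xs. f (Suc (lma (take i xs)))) = (\<Sum>k=1..lma xs. f k)"
  for f :: "nat \<Rightarrow> 'a::comm_monoid_add"
proof (induction xs rule: rev_induct)
  case Nil
  then show ?case by (simp add: lr_max_positions_def)
next
  case (snoc x xs)
  have eq: "lr_max_positions (xs @ [x]) = lr_max_positions xs \<union>
      (if \<forall>y\<in>set xs. y < x then {length xs} else {})"
    by (auto simp: lr_max_positions_def nth_append less_Suc_eq)
  have ni: "length xs \<notin> lr_max_positions xs" by (simp add: lr_max_positions_def)
  have "(\<Sum>i\<in>lr_max_positions xs. f (Suc (lma (take i (xs @ [x]))))) =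
      (\<Sum>i\<in>lr_max_positions xs. f (Suc (lma (take i xs))))"
    by (rule sum.cong) (auto simp: lr_max_positions_def)
  then show ?case using snoc ni by (auto simp: eq lma_snoc add.commute)
qed

lemma sum_rl_max_positions:
  "(\<Sum>i\<in>rl_max_positions xs. f (Suc (rma (drop (Suc i) xs)))) = (\<Sum>k=1..rma xs. f k)"
  for f :: "nat \<Rightarrow> 'a::comm_monoid_add"
proof (induction xs)
  case Nil
  then show ?case by (simp add: rl_max_positions_def)
next
  case (Cons x xs)
  have eq: "rl_max_positions (x # xs) = Suc ` rl_max_positions xs \<union>
      (if \<forall>y\<in>set xs. y < x then {0} else {})" (is "?L = ?R")
  proof (rule set_eqI)
    fix i show "i \<in> ?L \<longleftrightarrow> i \<in> ?R"
      by (cases i) (auto simp: rl_max_positions_def image_iff)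
  qed
  have "(\<Sum>i\<in>Suc ` rl_max_positions xs. f (Suc (rma (drop (Suc i) (x # xs))))) =
      (\<Sum>i\<in>rl_max_positions xs. f (Suc (rma (drop (Suc i) xs))))"
    by (subst sum.reindex) (auto simp: o_def)
  then show ?case using Cons by (auto simp: eq rma_Cons add.commute)
qed

section \<open>Vincular patterns and insertion of the largest letter\<close>

definition baxter_pattern :: "nat list \<Rightarrow> bool" where
  "baxter_pattern xs \<longleftrightarrow>
     (\<exists>as p q bs a c. xs = as @ p # q # bs \<and> a \<in> set as \<and> c \<in> set bs \<and>
        (q < a \<and> a < c \<and> c < p \<or> p < c \<and> c < a \<and> a < q))"

text \<open>The factorised form exhibits the adjacent pair \<open>p\<close>, \<open>q\<close>, so
  that inserting a letter is a matter of splitting lists; the link to the index form is made once,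
  here.\<close>

lemma baxter_pattern_iff_nth:
  "baxter_pattern xs \<longleftrightarrow>
    (\<exists>i j k. i < j \<and> j + 1 < k \<and> k < length xs \<and>
             (xs ! (j + 1) < xs ! i \<and> xs ! i < xs ! k \<and> xs ! k < xs ! j \<or>
              xs ! j < xs ! k \<and> xs ! k < xs ! i \<and> xs ! i < xs ! (j + 1)))"
  (is "_ = (\<exists>i j k. ?R i j k)")
proof
  assume "baxter_pattern xs"
  then obtain as p q bs a c where *: "xs = as @ p # q # bs" "a \<in> set as" "c \<in> set bs"
    "q < a \<and> a < c \<and> c < p \<or> p < c \<and> c < a \<and> a < q"
    unfolding baxter_pattern_def by blast
  from *(2,3) obtain i k where "i < length as" "as ! i = a" "k < length bs" "bs ! k = c"
    by (auto simp: in_set_conv_nth)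
  then have "?R i (length as) (length as + 2 + k)"
    using *(1,4) by (auto simp: nth_append)
  then show "\<exists>i j k. ?R i j k" by blast
next
  assume "\<exists>i j k. ?R i j k"
  then obtain i j k where R: "?R i j k" by blast
  have "drop j xs = xs ! j # xs ! (j + 1) # drop (j + 2) xs"
    using R by (simp add: Cons_nth_drop_Suc)
  then have "xs = take j xs @ xs ! j # xs ! (j + 1) # drop (j + 2) xs"
    by (metis append_take_drop_id)
  moreover have "xs ! i \<in> set (take j xs)"
    using R by (auto simp: in_set_conv_nth intro!: exI[of _ i])
  moreover obtain d where "k = j + 2 + d" using R
    by (metis Suc_leI add_2_eq_Suc' add.commute less_eqE Suc_eq_plus1)
  then have "xs ! k \<in> set (drop (j + 2) xs)"
    unfolding in_set_conv_nth using R by (intro exI[of _ d]) auto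
  ultimately show "baxter_pattern xs" unfolding baxter_pattern_def using R by blast
qed

lemma baxter_perms_altdef:
  "baxter_perms n = {\<pi> \<in> permutations_of_set {1..n}. \<not> baxter_pattern \<pi>}"
proof -
  have "length \<pi> = n" if "\<pi> \<in> permutations_of_set {1..n}" for \<pi>
    using length_finite_permutations_of_set[OF that] by simp
  then show ?thesis
    unfolding baxter_perms_def baxter_pattern_iff_nth by (intro Collect_cong conj_cong refl) simp
qed

lemma append_eq_append_Cons2_cases:
  assumes "as @ N # bs = cs @ p # q # ds"
  obtains (left) es where "as = cs @ p # q # es" "ds = es @ N # bs"
  | (mid_left) "as = cs @ [p]" "q = N" "ds = bs"
  | (mid_right) "cs = as" "p = N" "bs = q # ds"
  | (right) es where "cs = as @ N # es" "bs = es @ p # q # ds"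
  using assms by (auto simp: append_eq_append_conv2 append_eq_Cons_conv Cons_eq_append_conv)

text \<open>A pattern through the largest letter \<open>N\<close> must use it as the larger member
  of the adjacent pair; the other member is then \<open>last as\<close> or \<open>hd bs\<close>,
  which gives the last two alternatives. Conversely, a pattern of \<open>as @ bs\<close> whose
  adjacent pair is separated by \<open>N\<close> survives with \<open>N\<close> in place of the
  larger member.\<close>

lemma baxter_pattern_insert_max_iff:
  assumes "\<forall>a\<in>set as. a < N" "\<forall>b\<in>set bs. b < N"
  shows "baxter_pattern (as @ N # bs) \<longleftrightarrow> baxter_pattern (as @ bs) \<or>
     (as \<noteq> [] \<and> (\<exists>a\<in>set as. \<exists>c\<in>set bs. last as < c \<and> c < a)) \<or>
     (bs \<noteq> [] \<and> (\<exists>a\<in>set as. \<exists>c\<in>set bs. hd bs < a \<and> a < c))"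
  (is "?L \<longleftrightarrow> ?P \<or> ?Q \<or> ?R")
proof
  assume ?L
  then obtain cs p q ds a c where eq: "as @ N # bs = cs @ p # q # ds"
    and ac: "a \<in> set cs" "c \<in> set ds"
    and pat: "q < a \<and> a < c \<and> c < p \<or> p < c \<and> c < a \<and> a < q"
    unfolding baxter_pattern_def by blast
  from eq show "?P \<or> ?Q \<or> ?R"
  proof (cases rule: append_eq_append_Cons2_cases)
    case (left es)
    have "c \<noteq> N" using pat ac(1) left assms by auto
    then have "as @ bs = cs @ p # q # (es @ bs)" "c \<in> set (es @ bs)" using left ac by auto
    then have ?P unfolding baxter_pattern_def using ac(1) pat by blast
    then show ?thesis ..
  next
    case mid_left
    have "a < N" "c < N" using mid_left ac assms by auto
    then have "p < c" "c < a" using pat mid_left(2) by auto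
    then have ?Q using mid_left ac by fastforce
    then show ?thesis by blast
  next
    case mid_right
    have "a < N" "c < N" using mid_right ac assms by auto
    then have "q < a" "a < c" using pat mid_right(2) by auto
    then have ?R using mid_right ac by fastforce
    then show ?thesis by blast
  next
    case (right es)
    have "a \<noteq> N" using pat ac(2) right assms by auto
    then have "as @ bs = (as @ es) @ p # q # ds" "a \<in> set (as @ es)" using right ac by auto
    then have ?P unfolding baxter_pattern_def using ac(2) pat by blast
    then show ?thesis ..
  qed
next
  have Q: ?L if ?Q
  proof -
    from that obtain a c where *: "as \<noteq> []" "a \<in> set as" "c \<in> set bs" "last as < c" "c < a"
      by blast
    have "a \<in> set (butlast as)"
      using * by (cases as rule: rev_cases) auto
    moreover have "as @ N # bs = butlast as @ last as # N # bs" using *(1) by simp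
    moreover have "last as < c \<and> c < a \<and> a < N" using * assms(1) by auto
    ultimately show ?thesis unfolding baxter_pattern_def using *(3) by blast
  qed
  have R: ?L if ?R
  proof -
    from that obtain a c where *: "bs \<noteq> []" "a \<in> set as" "c \<in> set bs" "hd bs < a" "a < c"
      by blast
    then have "c \<in> set (tl bs)" by (cases bs) auto
    moreover have "as @ N # bs = as @ N # hd bs # tl bs" using *(1) by simp
    moreover have "hd bs < a \<and> a < c \<and> c < N" using * assms(2) by auto
    ultimately show ?thesis unfolding baxter_pattern_def using *(2) by blast
  qed
  have P: ?L if ?P
  proof -
    from that obtain cs p q ds a c where eq: "as @ bs = cs @ p # q # ds"
      and ac: "a \<in> set cs" "c \<in> set ds"
      and pat: "q < a \<and> a < c \<and> c < p \<or> p < c \<and> c < a \<and> a < q"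
      unfolding baxter_pattern_def by blast
    from eq consider (left) es where "as = cs @ p # q # es" "ds = es @ bs"
      | (mid) "as = cs @ [p]" "bs = q # ds"
      | (right) es where "cs = as @ es" "bs = es @ p # q # ds"
      by (auto simp: append_eq_append_conv2 append_eq_Cons_conv Cons_eq_append_conv)
    then show ?thesis
    proof cases
      case (left es)
      then have "as @ N # bs = cs @ p # q # (es @ N # bs)" "c \<in> set (es @ N # bs)" using ac by auto
      then show ?thesis unfolding baxter_pattern_def using ac(1) pat by blast
    next
      case mid
      \<comment> \<open>\<open>N\<close> separates \<open>p\<close> from \<open>q\<close>: it takes
        over the role of \<open>p\<close> in the first pattern and of \<open>q\<close> in the
        second.\<close>
      have "?Q \<or> ?R" using pat
      proof
        assume "q < a \<and> a < c \<and> c < p"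
        then have ?R using mid ac by auto
        then show ?thesis ..
      next
        assume "p < c \<and> c < a \<and> a < q"
        then have ?Q using mid ac by auto
        then show ?thesis ..
      qed
      then show ?thesis using Q R by blast
    next
      case (right es)
      then have "as @ N # bs = (as @ N # es) @ p # q # ds" "a \<in> set (as @ N # es)" using ac by auto
      then show ?thesis unfolding baxter_pattern_def using ac(2) pat by blast
    qed
  qed
  show "?P \<or> ?Q \<or> ?R \<Longrightarrow> ?L" using P Q R by blast
qed

text \<open>Let \<open>l\<close> and \<open>h\<close> be the letters next to the slot. If
  \<open>l < h\<close>, excluding \<open>l < c < a\<close> for \<open>c = h\<close> forces
  \<open>h\<close> above all of \<open>as\<close>, so \<open>h\<close> is a left-to-right maximum of
  \<open>as @ bs\<close>. Conversely, for such an \<open>h\<close>, a violation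
  \<open>l < c < a\<close> would make \<open>a\<close>, \<open>l\<close>, \<open>h\<close>,
  \<open>c\<close> a pattern already in \<open>as @ bs\<close>. The case \<open>h < l\<close> is the
  mirror image.\<close>

lemma baxter_insert_max_iff:
  assumes "\<forall>a\<in>set as. a < N" "\<forall>b\<in>set bs. b < N" "distinct (as @ bs)"
  shows "\<not> baxter_pattern (as @ N # bs) \<longleftrightarrow> \<not> baxter_pattern (as @ bs) \<and>
     (as = [] \<or> bs = [] \<or> (\<forall>a\<in>set as. a < hd bs) \<or> (\<forall>b\<in>set bs. b < last as))"
proof (cases "as = [] \<or> bs = [] \<or> baxter_pattern (as @ bs)")
  case True
  then show ?thesis using baxter_pattern_insert_max_iff[OF assms(1,2)] by auto
next
  case False
  then obtain as' l h bs' where eq: "as = as' @ [l]" "bs = h # bs'"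
    by (metis list.exhaust rev_exhaust)
  have nb: "\<not> baxter_pattern (as' @ l # h # bs')" using False eq by simp
  have *: "\<not> (\<exists>a\<in>set as. \<exists>c\<in>set bs. l < c \<and> c < a)" if "\<forall>a\<in>set as. a < h"
  proof
    assume "\<exists>a\<in>set as. \<exists>c\<in>set bs. l < c \<and> c < a"
    then obtain a c where ac: "a \<in> set as" "c \<in> set bs" "l < c" "c < a" by blast
    then have "a \<in> set as'" "c \<in> set bs'" "a < h" using that eq by auto
    then show False using nb ac(3,4) unfolding baxter_pattern_def by blast
  qed
  have **: "\<not> (\<exists>a\<in>set as. \<exists>c\<in>set bs. h < a \<and> a < c)" if "\<forall>b\<in>set bs. b < l"
  proof
    assume "\<exists>a\<in>set as. \<exists>c\<in>set bs. h < a \<and> a < c"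
    then obtain a c where ac: "a \<in> set as" "c \<in> set bs" "h < a" "a < c" by blast
    then have "a \<in> set as'" "c \<in> set bs'" "c < l" using that eq by auto
    then show False using nb ac(3,4) unfolding baxter_pattern_def by blast
  qed
  have ne: "a \<noteq> b" if "a \<in> set as" "b \<in> set bs" for a b using assms(3) that by auto
  have "(\<not> (\<exists>a\<in>set as. \<exists>c\<in>set bs. l < c \<and> c < a) \<and> \<not> (\<exists>a\<in>set as. \<exists>c\<in>set bs. h < a \<and> a < c))
     \<longleftrightarrow> (\<forall>a\<in>set as. a < h) \<or> (\<forall>b\<in>set bs. b < l)" (is "?A \<longleftrightarrow> ?B")
  proof
    assume A: ?A
    have mem: "l \<in> set as" "h \<in> set bs" using eq by auto
    then consider "l < h" | "h < l" using ne by (metis linorder_neqE_nat)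
    then show ?B
    proof cases
      case 1
      then have "\<forall>a\<in>set as. a < h" using A mem ne by (meson linorder_neqE_nat)
      then show ?thesis ..
    next
      case 2
      then have "\<forall>b\<in>set bs. b < l" using A mem ne by (metis linorder_neqE_nat)
      then show ?thesis ..
    qed
  next
    assume ?B
    then show ?A
    proof
      assume B: "\<forall>a\<in>set as. a < h"
      then show ?A using *[OF B] by (meson less_asym)
    next
      assume B: "\<forall>b\<in>set bs. b < l"
      then show ?A using **[OF B] by (meson less_asym)
    qed
  qed
  then show ?thesis using baxter_pattern_insert_max_iff[OF assms(1,2)] False eq by auto
qed

text \<open>Site \<open>i\<close> is the slot in front of position \<open>i\<close>, so the slot
  just behind a right-to-left maximum at \<open>i\<close> has number \<open>Suc i\<close>.\<close>

definition insertion_sites :: "nat list \<Rightarrow> nat set" where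
  "insertion_sites xs = lr_max_positions xs \<union> Suc ` rl_max_positions xs"

lemma lr_rl_max_positions_disjoint: "lr_max_positions xs \<inter> Suc ` rl_max_positions xs = {}"
proof -
  have False if "Suc i \<in> lr_max_positions xs" "i \<in> rl_max_positions xs" for i
  proof -
    have "xs ! i < xs ! Suc i"
      using that(1) unfolding lr_max_positions_def by (auto simp: take_Suc_conv_app_nth)
    moreover have "xs ! Suc i \<in> set (drop (Suc i) xs)"
      using that(1) by (simp add: lr_max_positions_def flip: Cons_nth_drop_Suc[of "Suc i" xs])
    then have "xs ! Suc i < xs ! i" using that(2) unfolding rl_max_positions_def by blast
    ultimately show False by simp
  qed
  then show ?thesis by blast
qed

text \<open>The two extreme slots belong to the sites because the first letter is always a
  left-to-right and the last letter always a right-to-left maximum. The empty list has no such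
  letters, hence \<open>xs\<close> is nonempty.\<close>

lemma insertion_sites_iff:
  assumes "xs \<noteq> []" "i \<le> length xs"
  shows "i \<in> insertion_sites xs \<longleftrightarrow> take i xs = [] \<or> drop i xs = [] \<or>
    (\<forall>a\<in>set (take i xs). a < hd (drop i xs)) \<or> (\<forall>b\<in>set (drop i xs). b < last (take i xs))"
proof -
  have 1: "i \<in> lr_max_positions xs \<longleftrightarrow> drop i xs \<noteq> [] \<and> (\<forall>a\<in>set (take i xs). a < hd (drop i xs))"
    using assms by (auto simp: lr_max_positions_def hd_drop_conv_nth)
  have 2: "i \<in> Suc ` rl_max_positions xs \<longleftrightarrow>
      take i xs \<noteq> [] \<and> (\<forall>b\<in>set (drop i xs). b < last (take i xs))"
    using assms by (cases i) (auto simp: rl_max_positions_def image_iff take_Suc_conv_app_nth)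
  show ?thesis unfolding insertion_sites_def Un_iff 1 2 using assms by auto
qed

lemma insertion_sites_le: "i \<in> insertion_sites xs \<Longrightarrow> i \<le> length xs"
  by (auto simp: insertion_sites_def lr_max_positions_def rl_max_positions_def)

lemma baxter_perms_Suc_iff:
  assumes "n \<ge> 1" "i \<le> length \<pi>" "Suc n \<notin> set \<pi>"
  shows "take i \<pi> @ Suc n # drop i \<pi> \<in> baxter_perms (Suc n) \<longleftrightarrow>
    \<pi> \<in> baxter_perms n \<and> i \<in> insertion_sites \<pi>"
proof (cases "\<pi> \<in> permutations_of_set {1..n}")
  case True
  then have S: "set \<pi> = {1..n}" "distinct \<pi>"
    by (auto simp: permutations_of_set_def)
  have dist: "distinct (take i \<pi> @ drop i \<pi>)" using S(2) by simp
  have lt: "\<forall>a\<in>set (take i \<pi>). a < Suc n" "\<forall>a\<in>set (drop i \<pi>). a < Suc n"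
    using S(1) by (auto dest!: in_set_takeD in_set_dropD)
  have "set (take i \<pi> @ Suc n # drop i \<pi>) = insert (Suc n) (set (take i \<pi> @ drop i \<pi>))"
    unfolding set_append by auto
  also have "\<dots> = {1..Suc n}" using S(1) unfolding append_take_drop_id by auto
  finally have "set (take i \<pi> @ Suc n # drop i \<pi>) = {1..Suc n}" .
  moreover have "distinct (take i \<pi> @ Suc n # drop i \<pi>)"
    using dist lt unfolding distinct_append by auto
  ultimately have "take i \<pi> @ Suc n # drop i \<pi> \<in> permutations_of_set {1..Suc n}"
    by (simp add: permutations_of_set_def)
  moreover have "\<pi> \<noteq> []" using S assms(1) by auto
  ultimately show ?thesis
    using True baxter_insert_max_iff[OF lt dist] insertion_sites_iff[of \<pi> i] assms(2)
    by (simp add: baxter_perms_altdef)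
next
  case False
  have "\<pi> \<in> permutations_of_set {1..n}"
    if "take i \<pi> @ Suc n # drop i \<pi> \<in> permutations_of_set {1..Suc n}"
  proof -
    have "set (take i \<pi> @ drop i \<pi>) \<union> {Suc n} = {1..Suc n}" "distinct (take i \<pi> @ drop i \<pi>)"
      using that unfolding permutations_of_set_def set_append distinct_append by auto
    then have "set \<pi> \<union> {Suc n} = {1..Suc n}" "distinct \<pi>" unfolding append_take_drop_id by auto
    moreover have "{1..Suc n} = insert (Suc n) {1..n}" by auto
    ultimately have "set \<pi> = {1..n}"
      using assms(3)
      by (metis Un_insert_right atLeastAtMost_iff insert_ident not_less_eq_eq order_refl sup_bot_right)
    then show ?thesis using \<open>distinct \<pi>\<close> by (simp add: permutations_of_set_def)
  qed
  then show ?thesis using False by (auto simp: baxter_perms_altdef)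
qed

lemma sum_baxter_perms_Suc:
  fixes g :: "nat list \<Rightarrow> 'a::comm_monoid_add"
  assumes "n \<ge> 1"
  shows "(\<Sum>\<sigma>\<in>baxter_perms (Suc n). g \<sigma>) =
    (\<Sum>\<pi>\<in>baxter_perms n. \<Sum>i\<in>insertion_sites \<pi>. g (take i \<pi> @ Suc n # drop i \<pi>))"
proof -
  have notin: "Suc n \<notin> set \<pi>" if "\<pi> \<in> baxter_perms n" for \<pi>
    using that by (auto simp: baxter_perms_altdef permutations_of_set_def)
  have fin: "finite (baxter_perms n)" "\<And>\<pi>. finite (insertion_sites \<pi>)"
    by (simp_all add: baxter_perms_altdef insertion_sites_def)
  have "(\<Sum>\<sigma>\<in>baxter_perms (Suc n). g \<sigma>) =
    (\<Sum>(\<pi>, i)\<in>Sigma (baxter_perms n) insertion_sites. g (take i \<pi> @ Suc n # drop i \<pi>))"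
  \<comment> \<open>The inverse of insertion deletes the largest letter and records the number of
    letters in front of it.\<close>
  proof (rule sum.reindex_bij_witness[where
          j = "\<lambda>\<sigma>. (remove1 (Suc n) \<sigma>, length (takeWhile (\<lambda>x. x \<noteq> Suc n) \<sigma>))"
        and i = "\<lambda>(\<pi>, i). take i \<pi> @ Suc n # drop i \<pi>"], goal_cases)
    case (4 z)
    then obtain \<pi> i where z: "z = (\<pi>, i)" "\<pi> \<in> baxter_perms n" "i \<in> insertion_sites \<pi>" by blast
    then show ?case using baxter_perms_Suc_iff[OF assms insertion_sites_le notin] by simp
  next
    case (3 z)
    then obtain \<pi> i where z: "z = (\<pi>, i)" "\<pi> \<in> baxter_perms n" "i \<in> insertion_sites \<pi>" by blast
    have "\<forall>x\<in>set (take i \<pi>). x \<noteq> Suc n" using notin[OF z(2)] by (auto dest: in_set_takeD)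
    moreover have "i \<le> length \<pi>" using z(3) by (rule insertion_sites_le)
    ultimately show ?case using z(1) by (auto simp: remove1_append takeWhile_append)
  next
    case (1 \<sigma>)
    then have S: "set \<sigma> = {1..Suc n}" "distinct \<sigma>"
      by (auto simp: baxter_perms_altdef permutations_of_set_def)
    then obtain as bs where \<sigma>: "\<sigma> = as @ Suc n # bs"
      by (metis atLeastAtMost_iff le_refl le_add1 plus_1_eq_Suc split_list)
    then have "Suc n \<notin> set as" using S by auto
    then show ?case using \<sigma> by (auto simp: remove1_append takeWhile_append)
  next
    case (2 \<sigma>)
    then have S: "set \<sigma> = {1..Suc n}" "distinct \<sigma>"
      by (auto simp: baxter_perms_altdef permutations_of_set_def)
    then obtain as bs where \<sigma>: "\<sigma> = as @ Suc n # bs"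
      by (metis atLeastAtMost_iff le_refl le_add1 plus_1_eq_Suc split_list)
    then have nin: "Suc n \<notin> set as" "Suc n \<notin> set bs" using S by auto
    then have eq: "remove1 (Suc n) \<sigma> = as @ bs" "length (takeWhile (\<lambda>x. x \<noteq> Suc n) \<sigma>) = length as"
      using \<sigma> by (auto simp: remove1_append takeWhile_append)
    show ?case using baxter_perms_Suc_iff[OF assms, of "length as" "as @ bs"] 2 \<sigma> nin
      unfolding eq by simp
  next
    case (5 \<sigma>)
    then have S: "set \<sigma> = {1..Suc n}" "distinct \<sigma>"
      by (auto simp: baxter_perms_altdef permutations_of_set_def)
    then obtain as bs where \<sigma>: "\<sigma> = as @ Suc n # bs"
      by (metis atLeastAtMost_iff le_refl le_add1 plus_1_eq_Suc split_list)
    then have "Suc n \<notin> set as" using S by auto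
    then show ?case using \<sigma> by (auto simp: remove1_append takeWhile_append)
  qed
  also have "\<dots> = (\<Sum>\<pi>\<in>baxter_perms n. \<Sum>i\<in>insertion_sites \<pi>. g (take i \<pi> @ Suc n # drop i \<pi>))"
    using fin by (subst sum.Sigma) auto
  finally show ?thesis .
qed

section \<open>Functional equation for Baxter permutations\<close>

definition baxter_gf :: "nat \<Rightarrow> real \<Rightarrow> real \<Rightarrow> real" where
  "baxter_gf n x y = (\<Sum>\<pi>\<in>baxter_perms n. x ^ lma \<pi> * y ^ rma \<pi>)"

lemma sum_insertion_sites:
  fixes x y :: real
  assumes "\<forall>a\<in>set \<pi>. a < N"
  shows "(\<Sum>i\<in>insertion_sites \<pi>.
      x ^ lma (take i \<pi> @ N # drop i \<pi>) * y ^ rma (take i \<pi> @ N # drop i \<pi>)) =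
    (\<Sum>i=1..lma \<pi>. x ^ i) * y ^ Suc (rma \<pi>) + x ^ Suc (lma \<pi>) * (\<Sum>j=1..rma \<pi>. y ^ j)"
proof -
  let ?w = "\<lambda>i. x ^ lma (take i \<pi> @ N # drop i \<pi>) * y ^ rma (take i \<pi> @ N # drop i \<pi>)"
  have w: "?w i = x ^ Suc (lma (take i \<pi>)) * y ^ Suc (rma (drop i \<pi>))" for i
  proof -
    have "\<forall>a\<in>set (take i \<pi>). a < N" "\<forall>a\<in>set (drop i \<pi>). a < N"
      using assms by (auto dest: in_set_takeD in_set_dropD)
    then show ?thesis by (simp add: lma_insert_max rma_insert_max)
  qed
  \<comment> \<open>Letters to the left of a left-to-right maximum are smaller than it, so none of
    them is a right-to-left maximum. Insertion at such a site therefore keeps all right-to-left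
    maxima and adds one; \<open>R\<close> is the mirror image.\<close>
  have L: "rma (drop i \<pi>) = rma \<pi>" if "i \<in> lr_max_positions \<pi>" for i
  proof -
    have i: "i < length \<pi>" "\<forall>a\<in>set (take i \<pi>). a < \<pi> ! i"
      using that by (auto simp: lr_max_positions_def)
    then show ?thesis
      using rma_append_left_max[OF i(2), of "drop (Suc i) \<pi>"] by (simp add: Cons_nth_drop_Suc)
  qed
  have R: "lma (take (Suc i) \<pi>) = lma \<pi>" if "i \<in> rl_max_positions \<pi>" for i
  proof -
    have i: "i < length \<pi>" "\<forall>a\<in>set (drop (Suc i) \<pi>). a < \<pi> ! i"
      using that by (auto simp: rl_max_positions_def)
    then show ?thesis
      using lma_append_right_max[OF i(2), of "take i \<pi>"]
      by (metis id_take_nth_drop take_Suc_conv_app_nth)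
  qed
  have "(\<Sum>i\<in>lr_max_positions \<pi>. ?w i) =
      (\<Sum>i\<in>lr_max_positions \<pi>. x ^ Suc (lma (take i \<pi>)) * y ^ Suc (rma \<pi>))"
    unfolding w by (intro sum.cong refl) (simp add: L)
  also have "\<dots> = (\<Sum>i=1..lma \<pi>. x ^ i) * y ^ Suc (rma \<pi>)"
    using sum_lr_max_positions[of "\<lambda>k. x ^ k * y ^ Suc (rma \<pi>)" \<pi>] by (simp add: sum_distrib_right)
  finally have 1: "(\<Sum>i\<in>lr_max_positions \<pi>. ?w i) = (\<Sum>i=1..lma \<pi>. x ^ i) * y ^ Suc (rma \<pi>)" .
  have "(\<Sum>i\<in>Suc ` rl_max_positions \<pi>. ?w i) =
      (\<Sum>i\<in>rl_max_positions \<pi>. x ^ Suc (lma \<pi>) * y ^ Suc (rma (drop (Suc i) \<pi>)))"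
    unfolding w by (subst sum.reindex) (auto intro!: sum.cong simp: R)
  also have "\<dots> = x ^ Suc (lma \<pi>) * (\<Sum>j=1..rma \<pi>. y ^ j)"
    using sum_rl_max_positions[of "\<lambda>k. x ^ Suc (lma \<pi>) * y ^ k" \<pi>] by (simp add: sum_distrib_left)
  finally show ?thesis unfolding insertion_sites_def
    using 1 by (subst sum.union_disjoint) (auto simp: lr_rl_max_positions_disjoint)
qed

text \<open>Keeping the denominator on the left makes the geometric sum usable at
  \<open>x = 1\<close> too.\<close>

lemma diff_one_mult_sum_power:
  "((x::real) - 1) * (\<Sum>i=1..k. x ^ i) = x * (x ^ k - 1)"
  by (induction k) (auto simp: algebra_simps)

lemma baxter_gf_Suc:
  assumes "n \<ge> 1"
  shows "(x - 1) * (y - 1) * baxter_gf (Suc n) x y =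
    x * y * ((x - 1 + (y - 1)) * baxter_gf n x y - (y - 1) * baxter_gf n 1 y - (x - 1) * baxter_gf n x 1)"
proof -
  \<comment> \<open>\<open>X\<close> and \<open>Y\<close> stand for the powers of \<open>x\<close>
    and \<open>y\<close>, and \<open>A\<close> and \<open>B\<close> for the geometric sums, which
    leaves a polynomial identity.\<close>
  have expand: "(x - 1) * (y - 1) * (A * (y * Y) + x * X * B) =
      x * y * ((x - 1 + (y - 1)) * (X * Y) - (y - 1) * Y - (x - 1) * X)"
    if "(x - 1) * A = x * (X - 1)" "(y - 1) * B = y * (Y - 1)" for X Y A B
  proof -
    have "(x - 1) * (y - 1) * (A * (y * Y) + x * X * B) =
        (y - 1) * (y * Y) * ((x - 1) * A) + (x - 1) * (x * X) * ((y - 1) * B)" by algebra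
    then show ?thesis unfolding that by algebra
  qed
  have "baxter_gf (Suc n) x y = (\<Sum>\<pi>\<in>baxter_perms n.
      (\<Sum>i=1..lma \<pi>. x ^ i) * y ^ Suc (rma \<pi>) + x ^ Suc (lma \<pi>) * (\<Sum>j=1..rma \<pi>. y ^ j))"
    unfolding baxter_gf_def sum_baxter_perms_Suc[OF assms]
    by (intro sum.cong refl sum_insertion_sites) (auto simp: baxter_perms_altdef permutations_of_set_def)
  then have "(x - 1) * (y - 1) * baxter_gf (Suc n) x y = (\<Sum>\<pi>\<in>baxter_perms n.
      (x - 1) * (y - 1) * ((\<Sum>i=1..lma \<pi>. x ^ i) * (y * y ^ rma \<pi>)
        + x * x ^ lma \<pi> * (\<Sum>j=1..rma \<pi>. y ^ j)))"
    by (simp only: sum_distrib_left[symmetric] power_Suc)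
  \<comment> \<open>The powers of 1 are written out so that the sums can be folded into boundary
    values of \<open>baxter_gf\<close>.\<close>
  also have "\<dots> = (\<Sum>\<pi>\<in>baxter_perms n. x * y * ((x - 1 + (y - 1)) * (x ^ lma \<pi> * y ^ rma \<pi>)
      - (y - 1) * (1 ^ lma \<pi> * y ^ rma \<pi>) - (x - 1) * (x ^ lma \<pi> * 1 ^ rma \<pi>)))"
    unfolding power_one mult_1_left mult_1_right
    by (rule sum.cong[OF refl expand[OF diff_one_mult_sum_power diff_one_mult_sum_power]])
  also have "\<dots> = x * y * ((x - 1 + (y - 1)) * baxter_gf n x y
      - (y - 1) * baxter_gf n 1 y - (x - 1) * baxter_gf n x 1)"
    unfolding baxter_gf_def by (simp only: sum_distrib_left sum_subtractf[symmetric])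
  finally show ?thesis .
qed

lemma baxter_gf_1: "baxter_gf 1 x y = x * y"
proof -
  have "permutations_of_set {1..1::nat} = {[1]}" by simp
  then have "baxter_perms 1 = {[1]}" unfolding baxter_perms_altdef
    by (auto simp: baxter_pattern_iff_nth)
  moreover have "lma [1] = 1" "rma [1] = 1" using lma_snoc[of "[]" 1] by (simp_all add: rma_Cons)
  ultimately show ?thesis by (simp add: baxter_gf_def)
qed

section \<open>Appending an entry to an inversion sequence\<close>

definition appendable :: "nat list \<Rightarrow> nat \<Rightarrow> bool" where
  "appendable e c \<longleftrightarrow>
     (\<forall>j<length e. \<forall>i<j. e ! j \<le> e ! i \<longrightarrow> \<not> (c \<le> e ! j \<and> c < e ! i))"

lemma inversion_seqs_snoc_iff:
  "e @ [c] \<in> inversion_seqs (Suc n) \<longleftrightarrow> e \<in> inversion_seqs n \<and> c \<le> n"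
  by (auto simp: inversion_seqs_def nth_append All_less_Suc)

text \<open>Forbidden triples are grouped by their last position \<open>k\<close>.\<close>

lemma inversion_seqs_avoiding_altdef:
  "inversion_seqs_avoiding n = {e \<in> inversion_seqs n. \<forall>k<n. appendable (take k e) (e ! k)}"
proof -
  have "(\<not> (\<exists>i j k. i < j \<and> j < k \<and> k < n \<and> e ! i \<ge> e ! j \<and> e ! j \<ge> e ! k \<and> e ! i > e ! k)) \<longleftrightarrow>
    (\<forall>k<n. appendable (take k e) (e ! k))" if "e \<in> inversion_seqs n" for e
    using that unfolding appendable_def inversion_seqs_def by auto
  then show ?thesis unfolding inversion_seqs_avoiding_def by blast
qed

lemma inversion_seqs_avoiding_snoc_iff:
  "e @ [c] \<in> inversion_seqs_avoiding (Suc n) \<longleftrightarrow>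
     e \<in> inversion_seqs_avoiding n \<and> c \<le> n \<and> appendable e c"
proof (cases "e \<in> inversion_seqs n")
  case True
  then have "length e = n" by (simp add: inversion_seqs_def)
  then show ?thesis
    by (auto simp: inversion_seqs_avoiding_altdef inversion_seqs_snoc_iff All_less_Suc nth_append)
qed (simp add: inversion_seqs_avoiding_altdef inversion_seqs_snoc_iff)

lemma appendable_mono: "appendable e c \<Longrightarrow> c \<le> d \<Longrightarrow> appendable e d"
  unfolding appendable_def by (meson le_less_trans le_trans)

lemma appendable_Max: "appendable e (Max (set e))"
  unfolding appendable_def
  by (metis List.finite_set Max_ge leD less_trans nth_mem)

lemma appendable_snoc:
  "appendable (e @ [d]) c \<longleftrightarrow> appendable e c \<and> (\<forall>a\<in>set e. d \<le> a \<longrightarrow> \<not> (c \<le> d \<and> c < a))"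
  unfolding appendable_def
  by (auto simp: All_less_Suc nth_append all_set_conv_all_nth)

lemma inversion_seqs_avoidingD:
  assumes "e \<in> inversion_seqs_avoiding n"
  shows "length e = n" "n \<ge> 1 \<Longrightarrow> Max (set e) < n"
proof -
  show len: "length e = n" using assms by (simp add: inversion_seqs_avoiding_def inversion_seqs_def)
  have lt: "a < n" if "a \<in> set e" for a
    using assms that
    by (fastforce simp: inversion_seqs_avoiding_def inversion_seqs_def in_set_conv_nth)
  assume "n \<ge> 1"
  then show "Max (set e) < n" using len lt by (subst Max_less_iff) auto
qed

lemma cri_eqI:
  assumes "e \<in> inversion_seqs_avoiding n" "m \<le> n" "\<And>c. appendable e c \<longleftrightarrow> m \<le> c"
  shows "cri e = m"
  unfolding cri_def inversion_seqs_avoidingD(1)[OF assms(1)] inversion_seqs_avoiding_snoc_iff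
  using assms by (intro Least_equality) auto

lemma
  assumes "e \<in> inversion_seqs_avoiding n" "n \<ge> 1"
  shows appendable_iff_cri_le: "appendable e c \<longleftrightarrow> cri e \<le> c"
    and cri_le_Max: "cri e \<le> Max (set e)"
proof -
  let ?m = "LEAST c. appendable e c"
  have iff: "appendable e c \<longleftrightarrow> ?m \<le> c" for c
    using LeastI[of "appendable e", OF appendable_Max] Least_le[of "appendable e"] appendable_mono
    by blast
  have le: "?m \<le> Max (set e)" using appendable_Max by (rule Least_le)
  \<comment> \<open>\<open>cri\<close> also requires the extended list to be an inversion sequence;
    this bound shows that the requirement does not shift the minimum.\<close>
  have "?m \<le> n" using le inversion_seqs_avoidingD(2)[OF assms] by linarith
  then have eq: "cri e = ?m" using iff by (rule cri_eqI[OF assms(1)])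
  show "appendable e c \<longleftrightarrow> cri e \<le> c" unfolding eq by (rule iff)
  show "cri e \<le> Max (set e)" unfolding eq by (rule le)
qed

text \<open>A new entry below the maximum completes a descent with it and so forbids every later
  letter up to \<open>c\<close>. An entry equal to the maximum forbids only the letters strictly
  below it. A new strict maximum is dominated by no earlier entry and forbids nothing new.\<close>

lemma cri_snoc:
  assumes "e \<in> inversion_seqs_avoiding n" "n \<ge> 1" "cri e \<le> c" "c \<le> n"
  shows "cri (e @ [c]) = (if c < Max (set e) then Suc c else if c = Max (set e) then c else cri e)"
proof (rule cri_eqI)
  have ne: "set e \<noteq> {}" using inversion_seqs_avoidingD(1)[OF assms(1)] assms(2) by auto
  have mem: "Max (set e) \<in> set e" and ge: "\<And>a. a \<in> set e \<Longrightarrow> a \<le> Max (set e)"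
    using ne by auto
  note app = appendable_iff_cri_le[OF assms(1,2)]
  note le = cri_le_Max[OF assms(1,2)] inversion_seqs_avoidingD(2)[OF assms(1,2)]
  show "e @ [c] \<in> inversion_seqs_avoiding (Suc n)"
    using assms app by (simp add: inversion_seqs_avoiding_snoc_iff)
  show "(if c < Max (set e) then Suc c else if c = Max (set e) then c else cri e) \<le> Suc n"
    using assms le by auto
  fix d
  show "appendable (e @ [c]) d \<longleftrightarrow>
    (if c < Max (set e) then Suc c else if c = Max (set e) then c else cri e) \<le> d"
  proof (cases c "Max (set e)" rule: linorder_cases)
    case less
    have "c < d" if "appendable (e @ [c]) d"
      using that mem less unfolding appendable_snoc by (meson less_imp_le not_le le_less_trans)
    then show ?thesis using less assms(3) by (auto simp: appendable_snoc app)
  next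
    case equal
    have "c \<le> d" if "appendable (e @ [c]) d"
      using that mem equal unfolding appendable_snoc by (meson less_imp_le not_le order_refl)
    moreover have "appendable (e @ [c]) d" if "c \<le> d"
      using that ge le equal unfolding appendable_snoc app by (auto simp: not_less dest: ge)
    ultimately show ?thesis using equal by auto
  next
    case greater
    then have "\<not> c \<le> a" if "a \<in> set e" for a using ge[OF that] by simp
    then show ?thesis using greater by (auto simp: appendable_snoc app)
  qed
qed

lemma inversion_seqs_avoiding_Suc_eq:
  assumes "n \<ge> 1"
  shows "inversion_seqs_avoiding (Suc n) =
    (\<lambda>(e, c). e @ [c]) ` Sigma (inversion_seqs_avoiding n) (\<lambda>e. {cri e..n})" (is "?L = ?R")
proof (intro equalityI subsetI)
  fix f assume f: "f \<in> ?L"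
  then have "length f = Suc n" by (rule inversion_seqs_avoidingD)
  then obtain e c where "f = e @ [c]" by (metis length_Suc_conv_rev)
  then show "f \<in> ?R"
    using f appendable_iff_cri_le assms by (auto simp: inversion_seqs_avoiding_snoc_iff)
next
  fix f assume "f \<in> ?R"
  then show "f \<in> ?L"
    using appendable_iff_cri_le assms by (auto simp: inversion_seqs_avoiding_snoc_iff)
qed

lemma finite_inversion_seqs_avoiding: "finite (inversion_seqs_avoiding n)"
proof (rule finite_subset)
  show "inversion_seqs_avoiding n \<subseteq> {e. set e \<subseteq> {..<n} \<and> length e = n}"
    by (fastforce simp: inversion_seqs_avoiding_def inversion_seqs_def in_set_conv_nth)
  show "finite {e. set e \<subseteq> {..<n} \<and> length e = n}" by (rule finite_lists_length_eq) simp
qed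

lemma sum_inversion_seqs_avoiding_Suc:
  fixes g :: "nat list \<Rightarrow> 'a::comm_monoid_add"
  assumes "n \<ge> 1"
  shows "(\<Sum>f\<in>inversion_seqs_avoiding (Suc n). g f) =
    (\<Sum>e\<in>inversion_seqs_avoiding n. \<Sum>c=cri e..n. g (e @ [c]))"
proof -
  have "inj_on (\<lambda>(e, c). e @ [c]) (Sigma (inversion_seqs_avoiding n) (\<lambda>e. {cri e..n}))"
    by (auto simp: inj_on_def)
  then show ?thesis unfolding inversion_seqs_avoiding_Suc_eq[OF assms]
    by (simp add: sum.reindex sum.Sigma finite_inversion_seqs_avoiding o_def case_prod_unfold)
qed

section \<open>Functional equation for inversion sequences\<close>

definition inversion_gf :: "nat \<Rightarrow> real \<Rightarrow> real \<Rightarrow> real" where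
  "inversion_gf n x y =
     (\<Sum>e\<in>inversion_seqs_avoiding n. x ^ (n - cri e) * y ^ (n - Max (set e)))"

lemma sum_append_weights:
  fixes x y :: real
  assumes "e \<in> inversion_seqs_avoiding n" "n \<ge> 1"
  defines "r \<equiv> n - cri e" and "k \<equiv> n - Max (set e)"
  shows "(x - 1) * (y - 1) * (\<Sum>c=cri e..n.
       x ^ (Suc n - cri (e @ [c])) * y ^ (Suc n - Max (set (e @ [c])))) =
     x * y * ((x - 1 + (y - 1)) * (x ^ r * y ^ k)
      + (y - 1) * (x - 1 - 1) * (x * y) ^ k - (x - 1) * x ^ r)"
proof -
  let ?m = "Max (set e)"
  let ?w = "\<lambda>c. x ^ (Suc n - cri (e @ [c])) * y ^ (Suc n - Max (set (e @ [c])))"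
  have ne: "set e \<noteq> {}" using inversion_seqs_avoidingD(1)[OF assms(1)] assms(2) by auto
  have le: "cri e \<le> ?m" "?m < n"
    using cri_le_Max[OF assms(1,2)] inversion_seqs_avoidingD(2)[OF assms(1,2)] by auto
  have Max: "Max (set (e @ [c])) = max c ?m" for c using ne by simp
  \<comment> \<open>With \<open>r\<close>, \<open>k\<close> as parameters, the three ranges give the
    children \<open>(j, k + 1)\<close> for \<open>k < j \<le> r\<close>, then
    \<open>(k + 1, k + 1)\<close>, then \<open>(r + 1, j)\<close> for
    \<open>1 \<le> j \<le> k\<close>.\<close>
  have split: "{cri e..n} = {cri e..<?m} \<union> {?m} \<union> {Suc ?m..n}" using le by auto
  have "(\<Sum>c=cri e..n. ?w c) = (\<Sum>c=cri e..<?m. ?w c) + ?w ?m + (\<Sum>c=Suc ?m..n. ?w c)"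
    unfolding split by (subst sum.union_disjoint, auto)+
  also have "(\<Sum>c=cri e..<?m. ?w c) = (\<Sum>c=cri e..<?m. x ^ (n - c) * y ^ Suc k)"
    unfolding Max k_def using le by (intro sum.cong refl) (auto simp: cri_snoc[OF assms(1,2)] Suc_diff_le)
  also have "\<dots> = (\<Sum>j=Suc k..r. x ^ j) * y ^ Suc k"
    unfolding sum_distrib_right r_def k_def using le
    by (intro sum.reindex_bij_witness[where i = "\<lambda>j. n - j" and j = "\<lambda>c. n - c"]) auto
  also have "?w ?m = (x * y) ^ Suc k"
    unfolding Max k_def using le by (simp add: cri_snoc[OF assms(1,2)] Suc_diff_le power_mult_distrib)
  also have "(\<Sum>c=Suc ?m..n. ?w c) = (\<Sum>c=Suc ?m..n. x ^ Suc r * y ^ (Suc n - c))"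
    unfolding Max r_def using le by (intro sum.cong refl) (auto simp: cri_snoc[OF assms(1,2)] Suc_diff_le)
  also have "\<dots> = x ^ Suc r * (\<Sum>j=1..k. y ^ j)"
    unfolding sum_distrib_left k_def using le
    by (intro sum.reindex_bij_witness[where i = "\<lambda>j. Suc n - j" and j = "\<lambda>c. Suc n - c"]) auto
  finally have eq: "(\<Sum>c=cri e..n. ?w c) =
    (\<Sum>j=Suc k..r. x ^ j) * y ^ Suc k + (x * y) ^ Suc k + x ^ Suc r * (\<Sum>j=1..k. y ^ j)" .
  have "k \<le> r" unfolding k_def r_def using le by simp
  then have "(\<Sum>j=1..r. x ^ j) = (\<Sum>j=1..k. x ^ j) + (\<Sum>j=Suc k..r. x ^ j)"
    by (subst sum.union_disjoint[symmetric]) (auto intro!: sum.cong)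
  then have gs: "(x - 1) * (\<Sum>j=Suc k..r. x ^ j) = x * (x ^ r - x ^ k)"
    using diff_one_mult_sum_power[of x r] diff_one_mult_sum_power[of x k] by (simp add: algebra_simps)
  have "(x - 1) * (y - 1) * (\<Sum>c=cri e..n. ?w c) =
      (y - 1) * y ^ Suc k * ((x - 1) * (\<Sum>j=Suc k..r. x ^ j)) + (x - 1) * (y - 1) * (x * y) ^ Suc k
      + (x - 1) * x ^ Suc r * ((y - 1) * (\<Sum>j=1..k. y ^ j))"
    unfolding eq distrib_left by (simp only: mult_ac)
  also have "\<dots> = x * y * ((x - 1 + (y - 1)) * (x ^ r * y ^ k)
      + (y - 1) * (x - 1 - 1) * (x * y) ^ k - (x - 1) * x ^ r)"
    unfolding gs diff_one_mult_sum_power by (simp add: algebra_simps power_mult_distrib)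
  finally show ?thesis .
qed

text \<open>The boundary term at \<open>(1, x * y)\<close> joins the child from repeating the
  maximum with the lower end of the geometric sum in \<open>x\<close>, whence the factor
  \<open>x - 1 - 1\<close>.\<close>

lemma inversion_gf_Suc:
  assumes "n \<ge> 1"
  shows "(x - 1) * (y - 1) * inversion_gf (Suc n) x y =
     x * y * ((x - 1 + (y - 1)) * inversion_gf n x y
       + (y - 1) * (x - 1 - 1) * inversion_gf n 1 (x * y) - (x - 1) * inversion_gf n x 1)"
proof -
  have "(x - 1) * (y - 1) * inversion_gf (Suc n) x y = (\<Sum>e\<in>inversion_seqs_avoiding n.
     x * y * ((x - 1 + (y - 1)) * (x ^ (n - cri e) * y ^ (n - Max (set e)))
       + (y - 1) * (x - 1 - 1) * (1 ^ (n - cri e) * (x * y) ^ (n - Max (set e)))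
       - (x - 1) * (x ^ (n - cri e) * 1 ^ (n - Max (set e)))))"
    unfolding inversion_gf_def sum_inversion_seqs_avoiding_Suc[OF assms]
    by (subst sum_distrib_left, intro sum.cong refl) 
      (simp only: sum_append_weights[OF _ assms] power_one mult_1_left mult_1_right)
  also have "\<dots> = x * y * ((x - 1 + (y - 1)) * inversion_gf n x y
       + (y - 1) * (x - 1 - 1) * inversion_gf n 1 (x * y) - (x - 1) * inversion_gf n x 1)"
    unfolding inversion_gf_def
    by (simp only: sum_distrib_left sum_subtractf[symmetric] sum.distrib[symmetric])
  finally show ?thesis .
qed

lemma inversion_seqs_avoiding_1: "inversion_seqs_avoiding 1 = {[0]}"
  by (auto simp: inversion_seqs_avoiding_def inversion_seqs_def length_Suc_conv)

lemma cri_singleton_0: "cri [0] = 0"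
  by (rule cri_eqI[of _ 1]) (auto simp: inversion_seqs_avoiding_1 appendable_def simp del: One_nat_def)

lemma inversion_gf_1: "inversion_gf 1 x y = x * y"
  by (simp add: inversion_gf_def inversion_seqs_avoiding_1[simplified] cri_singleton_0)

section \<open>Comparison of the generating functions\<close>

text \<open>Unprimed \<open>G\<close>, \<open>Sx\<close>, \<open>Sy\<close>, \<open>Rx\<close>,
  \<open>Ry\<close> have index n, whereas \<open>Fxy\<close>, \<open>Fyx\<close> and
  \<open>H\<close> have index n + 1, like \<open>G'\<close>, \<open>Sx'\<close> and
  \<open>Sy'\<close>. \<open>Rx\<close> and \<open>Ry\<close> are the boundary values of
  \<open>G\<close>, and \<open>H\<close> is the symmetric boundary term.\<close>

lemma key_identity_step:
  fixes a b x y :: real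
  assumes x: "x = 1 + a" and y: "y = 1 + b" and ab: "a \<noteq> 0" "b \<noteq> 0"
    and G': "a * b * G' = x * y * ((a + b) * G - b * Ry - a * Rx)"
    and F': "a * b * Fxy' = x * y * ((a + b) * Fxy + b * (a - 1) * H - a * Sx')"
    and F'': "a * b * Fyx' = x * y * ((a + b) * Fyx + a * (b - 1) * H - b * Sy')"
    and Ry: "2 * y * Ry = 2 * y\<^sup>2 * Sy - b * Sy'"
    and Rx: "2 * x * Rx = 2 * x\<^sup>2 * Sx - a * Sx'"
    and IH: "2 * (a + b) * x * y * G = (a - b) * (a * (b - 1) * Fxy - b * (a - 1) * Fyx)
    + 2 * x * y * (a * x * Sx + b * y * Sy)"
  shows "2 * (a + b) * x * y * G' = (a - b) * (a * (b - 1) * Fxy' - b * (a - 1) * Fyx')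
    + 2 * x * y * (a * x * Sx' + b * y * Sy')"
proof -
  have "a * b * (2 * (a + b) * x * y * G') = 2 * (a + b) * x * y * (a * b * G')" by (simp add: mult_ac)
  also have "\<dots> = x * y * (a + b) * (2 * (a + b) * x * y * G - b * x * (2 * y * Ry) - a * y * (2 * x * Rx))"
    unfolding G' by (simp add: algebra_simps)
  \<comment> \<open>The terms in \<open>Sx\<close> and \<open>Sy\<close> from the induction
    hypothesis cancel against those from the boundary values.\<close>
  also have "\<dots> = x * y * (a + b) * ((a - b) * (a * (b - 1) * Fxy - b * (a - 1) * Fyx)
    + a\<^sup>2 * y * Sx' + b\<^sup>2 * x * Sy')"
    unfolding IH Ry Rx by (simp add: algebra_simps power2_eq_square)
  \<comment> \<open>The weights \<open>a * (b - 1)\<close> and \<open>b * (a - 1)\<close> are chosen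
    so that both recurrences contribute the same multiple of \<open>H\<close>, which drops out of
    the difference.\<close>
  also have "\<dots> = (a - b) * (a * (b - 1) * (a * b * Fxy') - b * (a - 1) * (a * b * Fyx'))
    + a * b * (2 * x * y * (a * x * Sx' + b * y * Sy'))"
    unfolding F' F'' x y by algebra
  also have "\<dots> = a * b * ((a - b) * (a * (b - 1) * Fxy' - b * (a - 1) * Fyx')
    + 2 * x * y * (a * x * Sx' + b * y * Sy'))"
    by algebra
  finally show ?thesis using ab by simp
qed

lemma eq_at_isolated_point:
  fixes f g :: "real \<Rightarrow> real"
  assumes "isCont f c" "isCont g c" "\<And>x. x \<noteq> c \<Longrightarrow> f x = g x"
  shows "f c = g c"
proof -
  have "(f \<longlongrightarrow> g c) (at c)"
    using assms(2,3) LIM_equal[of c f g] unfolding isCont_def by simp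
  with assms(1) show ?thesis unfolding isCont_def by (rule LIM_unique)
qed

lemma isCont_baxter_gf [continuous_intros]:
  "isCont f c \<Longrightarrow> isCont g c \<Longrightarrow> isCont (\<lambda>x. baxter_gf n (f x) (g x)) c"
  unfolding baxter_gf_def by (intro continuous_intros)

lemma isCont_inversion_gf [continuous_intros]:
  "isCont f c \<Longrightarrow> isCont g c \<Longrightarrow> isCont (\<lambda>x. inversion_gf n (f x) (g x)) c"
  unfolding inversion_gf_def by (intro continuous_intros)

definition key_identity :: "nat \<Rightarrow> real \<Rightarrow> real \<Rightarrow> bool" where
  "key_identity n x y \<longleftrightarrow> 2 * ((x - 1) + (y - 1)) * x * y * baxter_gf n x y =
     ((x - 1) - (y - 1)) * ((x - 1) * ((y - 1) - 1) * inversion_gf (Suc n) x y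
       - (y - 1) * ((x - 1) - 1) * inversion_gf (Suc n) y x)
     + 2 * x * y * ((x - 1) * x * inversion_gf n x 1 + (y - 1) * y * inversion_gf n y 1)"

text \<open>The identity is available only off the lines \<open>x = 1\<close> and
  \<open>y = 1\<close>. All terms are polynomial, so it extends there by continuity; a common factor
  \<open>t - 1\<close> then cancels.\<close>

lemma key_identity_boundary:
  assumes "\<And>x y. x \<noteq> 1 \<Longrightarrow> y \<noteq> 1 \<Longrightarrow> key_identity n x y" and "t \<noteq> 1"
  shows "2 * t * baxter_gf n 1 t = 2 * t\<^sup>2 * inversion_gf n t 1 - (t - 1) * inversion_gf (Suc n) t 1"
    and "2 * t * baxter_gf n t 1 = 2 * t\<^sup>2 * inversion_gf n t 1 - (t - 1) * inversion_gf (Suc n) t 1"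
proof -
  have "key_identity n 1 t"
    unfolding key_identity_def
    by (rule eq_at_isolated_point[OF _ _ assms(1)[OF _ assms(2), unfolded key_identity_def]])
      (intro continuous_intros)+
  then have "(t - 1) * (2 * t * baxter_gf n 1 t) =
      (t - 1) * (2 * t\<^sup>2 * inversion_gf n t 1 - (t - 1) * inversion_gf (Suc n) t 1)"
    unfolding key_identity_def by algebra
  then show "2 * t * baxter_gf n 1 t = 2 * t\<^sup>2 * inversion_gf n t 1 - (t - 1) * inversion_gf (Suc n) t 1"
    using assms(2) by simp
  have "key_identity n t 1"
    unfolding key_identity_def
    by (rule eq_at_isolated_point[OF _ _ assms(1)[OF assms(2), unfolded key_identity_def]])
      (intro continuous_intros)+
  then have "(t - 1) * (2 * t * baxter_gf n t 1) =
      (t - 1) * (2 * t\<^sup>2 * inversion_gf n t 1 - (t - 1) * inversion_gf (Suc n) t 1)"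
    unfolding key_identity_def by algebra
  then show "2 * t * baxter_gf n t 1 = 2 * t\<^sup>2 * inversion_gf n t 1 - (t - 1) * inversion_gf (Suc n) t 1"
    using assms(2) by simp
qed

text \<open>The points stay arbitrary in the induction because the boundary values come from limits
  of the identity at other points.\<close>

lemma key_identity:
  assumes "n \<ge> 1" "x \<noteq> 1" "y \<noteq> 1"
  shows "key_identity n x y"
  using assms
proof (induction n arbitrary: x y rule: dec_induct)
  case base
  have F: "(x - 1) * (y - 1) * inversion_gf (Suc 1) x y =
      x * y * ((x - 1 + (y - 1)) * (x * y) + (y - 1) * (x - 1 - 1) * (x * y) - (x - 1) * x)" for x y
    using inversion_gf_Suc[of 1 x y] by (simp only: inversion_gf_1 order_refl mult_1_left mult_1_right)
  have "(x - 1) * (y - 1) * (2 * ((x - 1) + (y - 1)) * x * y * (x * y)) =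
     ((x - 1) - (y - 1)) * ((x - 1) * ((y - 1) - 1) * ((x - 1) * (y - 1) * inversion_gf (Suc 1) x y)
       - (y - 1) * ((x - 1) - 1) * ((y - 1) * (x - 1) * inversion_gf (Suc 1) y x))
     + (x - 1) * (y - 1) * (2 * x * y * ((x - 1) * x * x + (y - 1) * y * y))"
    unfolding F by algebra
  also have "\<dots> = (x - 1) * (y - 1) * (
     ((x - 1) - (y - 1)) * ((x - 1) * ((y - 1) - 1) * inversion_gf (Suc 1) x y
       - (y - 1) * ((x - 1) - 1) * inversion_gf (Suc 1) y x)
     + 2 * x * y * ((x - 1) * x * x + (y - 1) * y * y))"
    by algebra
  finally show ?case
    using base unfolding key_identity_def inversion_gf_1 baxter_gf_1 by (simp del: One_nat_def)
next
  case (step n)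
  note bd = key_identity_boundary[OF step.IH]
  \<comment> \<open>The recurrence with \<open>x\<close> and \<open>y\<close> exchanged has the same
    boundary term, since \<open>y * x = x * y\<close>.\<close>
  have F: "(x - 1) * (y - 1) * inversion_gf (Suc (Suc n)) y x =
      x * y * ((x - 1 + (y - 1)) * inversion_gf (Suc n) y x
      + (x - 1) * (y - 1 - 1) * inversion_gf (Suc n) 1 (x * y) - (y - 1) * inversion_gf (Suc n) y 1)"
    using inversion_gf_Suc[of "Suc n" y x] by (simp only: mult_ac add_ac)
  show ?case
    unfolding key_identity_def
  proof (rule key_identity_step)
    show "(x - 1) * (y - 1) * baxter_gf (Suc n) x y = x * y * ((x - 1 + (y - 1)) * baxter_gf n x y
        - (y - 1) * baxter_gf n 1 y - (x - 1) * baxter_gf n x 1)"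
      using step.hyps(1) by (rule baxter_gf_Suc)
    show "(x - 1) * (y - 1) * inversion_gf (Suc (Suc n)) x y =
        x * y * ((x - 1 + (y - 1)) * inversion_gf (Suc n) x y
        + (y - 1) * (x - 1 - 1) * inversion_gf (Suc n) 1 (x * y) - (x - 1) * inversion_gf (Suc n) x 1)"
      by (rule inversion_gf_Suc) simp
    show "2 * ((x - 1) + (y - 1)) * x * y * baxter_gf n x y =
     ((x - 1) - (y - 1)) * ((x - 1) * ((y - 1) - 1) * inversion_gf (Suc n) x y
       - (y - 1) * ((x - 1) - 1) * inversion_gf (Suc n) y x)
     + 2 * x * y * ((x - 1) * x * inversion_gf n x 1 + (y - 1) * y * inversion_gf n y 1)"
      using step.IH[OF step.prems] unfolding key_identity_def .
  qed (use step.prems bd F in simp_all)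
qed

text \<open>At \<open>y = x\<close> the factor \<open>(x - 1) - (y - 1)\<close> removes the terms of
  index \<open>Suc n\<close>; what remains is divided by \<open>(x - 1) * x\<^sup>2\<close>.\<close>

lemma baxter_gf_diagonal:
  assumes "n \<ge> 1" "x \<noteq> 0" "x \<noteq> 1"
  shows "baxter_gf n x x = x * inversion_gf n x 1"
proof -
  have "(x - 1) * x\<^sup>2 * baxter_gf n x x = (x - 1) * x\<^sup>2 * (x * inversion_gf n x 1)"
    using key_identity[OF assms(1,3,3)] unfolding key_identity_def by algebra
  then show ?thesis using assms by simp
qed

text \<open>Real polynomials agreeing at infinitely many points have equal coefficients, and these
  count exponents. Hence the multisets of exponents coincide, which yields the identity in any
  commutative semiring, even without subtraction.\<close>

lemma sum_power_eq_transfer: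
  fixes f :: "'b \<Rightarrow> nat" and g :: "'c \<Rightarrow> nat" and u :: "'a::comm_semiring_1"
  assumes "finite A" "finite B" "finite X"
    and eq: "\<And>x::real. x \<notin> X \<Longrightarrow> (\<Sum>a\<in>A. x ^ f a) = (\<Sum>b\<in>B. x ^ g b)"
  shows "(\<Sum>a\<in>A. u ^ f a) = (\<Sum>b\<in>B. u ^ g b)"
proof -
  have coeff: "coeff (\<Sum>a\<in>A. monom (1::real) (f a)) s = real (count (image_mset f (mset_set A)) s)"
    if "finite A" for A :: "'d set" and f s
    using that by (induction A) auto
  let ?P = "(\<Sum>a\<in>A. monom (1::real) (f a)) - (\<Sum>b\<in>B. monom 1 (g b))"
  have "- X \<subseteq> {x. poly ?P x = 0}" using eq by (auto simp: poly_sum poly_monom)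
  moreover have "infinite (- X)" using assms(3) by (simp add: finite_compl infinite_UNIV_char_0)
  ultimately have "?P = 0" using poly_roots_finite finite_subset by blast
  then have "image_mset f (mset_set A) = image_mset g (mset_set B)"
    using coeff[OF assms(1), of f] coeff[OF assms(2), of g]
    by (intro multiset_eqI) (metis eq_iff_diff_eq_0 of_nat_eq_iff)
  then have "image_mset (\<lambda>k. u ^ k) (image_mset f (mset_set A)) =
      image_mset (\<lambda>k. u ^ k) (image_mset g (mset_set B))" by simp
  then show ?thesis by (simp add: sum_unfold_sum_mset multiset.map_comp o_def)
qed

theorem theorem4p1:
  fixes n :: nat and u :: "'a::comm_semiring_1"
  assumes "n \<ge> 1"
  shows "(\<Sum>e\<in>inversion_seqs_avoiding n. u ^ (n + 1 - cri e)) =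
         (\<Sum>\<pi>\<in>baxter_perms n. u ^ (lma \<pi> + rma \<pi>))"
proof (rule sum_power_eq_transfer[where X = "{0, 1}"])
  fix x :: real
  assume x: "x \<notin> {0, 1}"
  have "(\<Sum>e\<in>inversion_seqs_avoiding n. x ^ (n + 1 - cri e)) = x * inversion_gf n x 1"
    unfolding inversion_gf_def sum_distrib_left
  proof (intro sum.cong refl)
    fix e assume e: "e \<in> inversion_seqs_avoiding n"
    \<comment> \<open>Truncated subtraction is thus exact, and raising \<open>n\<close> to
      \<open>n + 1\<close> contributes one factor \<open>x\<close>.\<close>
    have "cri e \<le> n"
      using cri_le_Max[OF e assms] inversion_seqs_avoidingD(2)[OF e assms] by linarith
    then show "x ^ (n + 1 - cri e) = x * (x ^ (n - cri e) * 1 ^ (n - Max (set e)))"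
      by (simp add: Suc_diff_le)
  qed
  also have "\<dots> = baxter_gf n x x" using baxter_gf_diagonal[OF assms] x by simp
  also have "\<dots> = (\<Sum>\<pi>\<in>baxter_perms n. x ^ (lma \<pi> + rma \<pi>))"
    by (simp add: baxter_gf_def power_add)
  finally show "(\<Sum>e\<in>inversion_seqs_avoiding n. x ^ (n + 1 - cri e)) =
    (\<Sum>\<pi>\<in>baxter_perms n. x ^ (lma \<pi> + rma \<pi>))" .
qed (simp_all add: finite_inversion_seqs_avoiding baxter_perms_altdef)

end
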